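(* Let $\mathcal{A}\in\mathbb{R}^{n_1\times\cdots\times n_k}$. Then ${\rm mr}(\mathcal{A})=1$ if and only if ${\rm sgn}(\mathcal{C}(\mathcal{A}))$ is $+$ or $-$ (i.e. the condensed tensor $\mathcal{C}(\mathcal{A})$ consists of a single entry, which is nonzero).
   Context: For a real tensor $\mathcal{A}$, ${\rm sgn}(\mathcal{A})$ is the entrywise sign tensor and $\mathcal{Q}(\mathcal{A})=\{\hat{\mathcal{A}}:{\rm sgn}(\hat{\mathcal{A}})={\rm sgn}(\mathcal{A})\}$. A rank one tensor is $\alpha_1\otimes\cdots\otimes\alpha_k$ with nonzero vectors $\alpha_j$, entries $(\alpha_1)_{i_1}\cdots(\alpha_k)_{i_k}$; ${\rm rank}(\mathcal{A})$ is the smallest number of rank one tensors summing to $\mathcal{A}$; ${\rm mr}(\mathcal{A})=\min\{{\rm rank}(\mathcal{B}):\mathcal{B}\in\mathcal{Q}(\mathcal{A})\}$. For $j\in[k]$ and $i\in[n_j]$, the slice $(\mathcal{A})^{(j)}_i$ is the subtensor obtained by fixing the $j$-th index equal to $i$, and $\mathcal{A}=((\mathcal{A})^{(j)}_1,\ldots,(\mathcal{A})^{(j)}_{n_j})$ is the $j$-th order unfolding. The condensed tensor $\mathcal{C}(\mathcal{A})$ is obtained as follows: successively for $j=1,2,\ldots,k$, in the $j$-th order unfolding of the current tensor delete every slice whose sign pattern is zero, and delete every slice whose sign pattern is the same as, or the negative of, the sign pattern of another remaining slice (so that among such slices only one is kept). *)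

theory Defs
  imports Complex_Main
begin

text \<open>
  A real tensor of order \<open>k\<close> is given by its list of dimensions and a function on
  multi-indices, which are lists of length \<open>k\<close>. Modes and indices are counted from 0. Values of
  the entry function outside \<open>multi_indices\<close> carry no meaning; equality of tensors is therefore
  \<open>tensor_eq\<close>. A dimension may be 0, since the condensation of a zero tensor has no entries left.
\<close>

datatype tensor = Tensor (dims: "nat list") (entry: "nat list \<Rightarrow> real")

definition multi_indices :: "nat list \<Rightarrow> nat list set" where
  "multi_indices ns = {is. length is = length ns \<and> (\<forall>j<length ns. is ! j < ns ! j)}"

definition tensor_eq :: "tensor \<Rightarrow> tensor \<Rightarrow> bool"  (infix "\<simeq>" 50) where
  "A \<simeq> B \<longleftrightarrow> dims A = dims B \<and> (\<forall>is\<in>multi_indices (dims A). entry A is = entry B is)"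

definition const_tensor :: "nat list \<Rightarrow> real \<Rightarrow> tensor" where
  "const_tensor ns c = Tensor ns (\<lambda>_. c)"

definition neg_tensor :: "tensor \<Rightarrow> tensor" where
  "neg_tensor A = Tensor (dims A) (\<lambda>is. - entry A is)"

definition sgn_tensor :: "tensor \<Rightarrow> tensor" where
  "sgn_tensor A = Tensor (dims A) (\<lambda>is. sgn (entry A is))"

definition sign_class :: "tensor \<Rightarrow> tensor set" where
  "sign_class A = {B. sgn_tensor B \<simeq> sgn_tensor A}"


subsection \<open>Rank and minimum rank\<close>

text \<open>The vector \<open>\<alpha> j\<close> has the components \<open>\<alpha> j i\<close> for \<open>i < ns ! j\<close>.\<close>

definition outer_product :: "nat list \<Rightarrow> (nat \<Rightarrow> nat \<Rightarrow> real) \<Rightarrow> tensor" where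
  "outer_product ns \<alpha> = Tensor ns (\<lambda>is. \<Prod>j<length ns. \<alpha> j (is ! j))"

definition rank_one :: "tensor \<Rightarrow> bool" where
  "rank_one B \<longleftrightarrow>
     (\<exists>\<alpha>. (\<forall>j<length (dims B). \<exists>i<dims B ! j. \<alpha> j i \<noteq> 0) \<and> B \<simeq> outer_product (dims B) \<alpha>)"

definition sum_tensor :: "nat list \<Rightarrow> nat \<Rightarrow> (nat \<Rightarrow> tensor) \<Rightarrow> tensor" where
  "sum_tensor ns r T = Tensor ns (\<lambda>is. \<Sum>l<r. entry (T l) is)"

text \<open>The empty sum is the zero tensor, which thus has rank 0.\<close>

definition tensor_rank :: "tensor \<Rightarrow> nat" where
  "tensor_rank A = (LEAST r. \<exists>T. (\<forall>l<r. dims (T l) = dims A \<and> rank_one (T l)) \<and>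
                                 A \<simeq> sum_tensor (dims A) r T)"

definition mr :: "tensor \<Rightarrow> nat" where
  "mr A = (LEAST r. \<exists>B\<in>sign_class A. tensor_rank B = r)"


subsection \<open>Slices and condensed tensors\<close>

text \<open>\<open>slice j i A\<close> is the tensor of order \<open>k - 1\<close> obtained by fixing the index of mode \<open>j\<close> to \<open>i\<close>.\<close>

definition slice :: "nat \<Rightarrow> nat \<Rightarrow> tensor \<Rightarrow> tensor" where
  "slice j i A = Tensor (take j (dims A) @ drop (Suc j) (dims A))
                        (\<lambda>is. entry A (take j is @ i # drop j is))"

definition zero_pattern :: "tensor \<Rightarrow> bool" where
  "zero_pattern S \<longleftrightarrow> sgn_tensor S \<simeq> const_tensor (dims S) 0"

definition same_or_neg_pattern :: "tensor \<Rightarrow> tensor \<Rightarrow> bool" where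
  "same_or_neg_pattern S S' \<longleftrightarrow>
     sgn_tensor S \<simeq> sgn_tensor S' \<or> sgn_tensor S \<simeq> neg_tensor (sgn_tensor S')"

text \<open>Keeping the slices of mode \<open>j\<close> with index in \<open>K\<close>, renumbered in increasing order.\<close>

definition keep_slices :: "nat \<Rightarrow> nat set \<Rightarrow> tensor \<Rightarrow> tensor" where
  "keep_slices j K A = Tensor ((dims A)[j := card K])
                              (\<lambda>is. entry A (is[j := sorted_list_of_set K ! (is ! j)]))"

text \<open>
  The admissible sets of kept slices in mode \<open>j\<close>: the zero slices are deleted, and each class of
  nonzero slices whose sign patterns agree up to a global sign keeps exactly one member.
\<close>

definition kept_indices :: "nat \<Rightarrow> tensor \<Rightarrow> nat set set" where
  "kept_indices j A = {K. K \<subseteq> {..<dims A ! j} \<and>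
     (\<forall>i\<in>K. \<not> zero_pattern (slice j i A)) \<and>
     (\<forall>i\<in>K. \<forall>i'\<in>K. same_or_neg_pattern (slice j i A) (slice j i' A) \<longrightarrow> i = i') \<and>
     (\<forall>i<dims A ! j. \<not> zero_pattern (slice j i A) \<longrightarrow>
        (\<exists>i'\<in>K. same_or_neg_pattern (slice j i A) (slice j i' A)))}"

text \<open>
  Which member of a class is kept is left open, so \<open>\<C>(A)\<close> is represented by the set of all
  possible outcomes of processing the modes successively. \<open>T j\<close> is the tensor before mode \<open>j\<close>
  is processed.
\<close>

definition condensed_tensors :: "tensor \<Rightarrow> tensor set" where
  "condensed_tensors A = {C. \<exists>T. T 0 = A \<and>
     (\<forall>j<length (dims A). \<exists>K\<in>kept_indices j (T j). T (Suc j) = keep_slices j K (T j)) \<and>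
     C = T (length (dims A))}"

text \<open>Condensed tensors always exist, so quantifying over them is never vacuous.\<close>

lemma same_or_neg_pattern_refl: "same_or_neg_pattern S S"
  by (simp add: same_or_neg_pattern_def tensor_eq_def)

lemma same_or_neg_pattern_sym: "same_or_neg_pattern S S' \<Longrightarrow> same_or_neg_pattern S' S"
  by (auto simp: same_or_neg_pattern_def tensor_eq_def sgn_tensor_def neg_tensor_def)

lemma same_or_neg_pattern_trans:
  "same_or_neg_pattern S S' \<Longrightarrow> same_or_neg_pattern S' S'' \<Longrightarrow> same_or_neg_pattern S S''"
  by (auto simp: same_or_neg_pattern_def tensor_eq_def sgn_tensor_def neg_tensor_def)

lemma zero_pattern_cong:
  "same_or_neg_pattern S S' \<Longrightarrow> zero_pattern S \<Longrightarrow> zero_pattern S'"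
  by (auto simp: same_or_neg_pattern_def zero_pattern_def const_tensor_def tensor_eq_def
      sgn_tensor_def neg_tensor_def)

lemma kept_indices_nonempty: "kept_indices j A \<noteq> {}"
proof -
  let ?R = "\<lambda>i i'. same_or_neg_pattern (slice j i A) (slice j i' A)"
  let ?N = "\<lambda>i. i < dims A ! j \<and> \<not> zero_pattern (slice j i A)"
  define K where "K = {i. ?N i \<and> (\<forall>i'<i. ?N i' \<longrightarrow> \<not> ?R i i')}"
  have inj: "i = i'" if "i \<in> K" "i' \<in> K" "?R i i'" for i i'
    using that same_or_neg_pattern_sym[OF that(3)] unfolding K_def
    by (cases i i' rule: linorder_cases) auto
  have cover: "\<exists>i'\<in>K. ?R i i'" if "?N i" for i
    using that
  proof (induction i rule: less_induct)
    case (less i)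
    show ?case
    proof (cases "\<exists>i'<i. ?N i' \<and> ?R i i'")
      case True
      then show ?thesis
        using less.IH same_or_neg_pattern_trans by blast
    next
      case False
      then show ?thesis
        using less.prems same_or_neg_pattern_refl unfolding K_def by blast
    qed
  qed
  have "K \<in> kept_indices j A"
    unfolding kept_indices_def using inj cover by (auto simp: K_def)
  then show ?thesis by blast
qed

lemma condensed_tensors_nonempty: "condensed_tensors A \<noteq> {}"
proof -
  define T where
    "T = rec_nat A (\<lambda>j B. keep_slices j (SOME K. K \<in> kept_indices j B) B)"
  have "(SOME K. K \<in> kept_indices j (T j)) \<in> kept_indices j (T j)" for j
    using kept_indices_nonempty some_in_eq by blast
  then have "T (length (dims A)) \<in> condensed_tensors A"
    unfolding condensed_tensors_def by (auto simp: T_def intro!: exI[of _ T])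
  then show ?thesis by blast
qed

end

theory Submission
  imports Defs
begin

text \<open>
  A sign class contains a rank one tensor exactly when the sign tensor factors as an outer product
  of sign vectors, none of them zero. This property is invariant under deleting the redundant
  slices of a mode: a deleted slice is \<open>0\<close> or \<open>\<plusminus>\<close> a kept one, which gives the missing
  components of the factor of that mode. Moreover, all nonzero slices of such a tensor have the
  same pattern up to a global sign, so each condensation step leaves exactly one of them.
\<close>

section \<open>Multi-indices and slices\<close>

lemma multi_indices_update:
  assumes "x \<in> multi_indices ns" and "i < n"
  shows "x[j := i] \<in> multi_indices (ns[j := n])"
  using assms by (cases "j < length ns") (auto simp: multi_indices_def nth_list_update)

lemma multi_indices_update_same:
  assumes "x \<in> multi_indices ns" and "i < ns ! j"
  shows "x[j := i] \<in> multi_indices ns"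
  using multi_indices_update[OF assms, of j] by simp

lemma finite_multi_indices: "finite (multi_indices ns)"
proof (rule finite_subset)
  show "multi_indices ns \<subseteq> {is. set is \<subseteq> {..<Suc (sum_list ns)} \<and> length is = length ns}"
  proof (clarsimp simp: multi_indices_def)
    fix x y assume x: "length x = length ns" "\<forall>j<length ns. x ! j < ns ! j" and "y \<in> set x"
    then obtain j where "j < length ns" "y = x ! j" by (metis in_set_conv_nth)
    then show "y < Suc (sum_list ns)"
      using x elem_le_sum_list[of j ns] by (metis less_imp_le order_le_less_trans
          le_imp_less_Suc order_trans)
  qed
qed (simp add: finite_lists_length_eq)

text \<open>Lets conditions on a slice be stated with full-length multi-indices and
  \<open>x[j := i]\<close>. Dropping coordinate \<open>j\<close> and inserting it again match the
  two index sets; \<open>0 < ns ! j\<close> ensures that every slice index extends to an index of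
  the tensor.\<close>

lemma ball_multi_indices_slice:
  assumes j: "j < length ns" and pos: "0 < ns ! j"
  shows "(\<forall>y\<in>multi_indices (take j ns @ drop (Suc j) ns). P (take j y @ i # drop j y)) \<longleftrightarrow>
         (\<forall>x\<in>multi_indices ns. P (x[j := i]))"
proof (intro iffI ballI)
  fix x assume L: "\<forall>y\<in>multi_indices (take j ns @ drop (Suc j) ns). P (take j y @ i # drop j y)"
    and x: "x \<in> multi_indices ns"
  let ?y = "take j x @ drop (Suc j) x"
  have "?y \<in> multi_indices (take j ns @ drop (Suc j) ns)"
    using x j by (auto simp: multi_indices_def nth_append min_def)
  moreover have "take j ?y @ i # drop j ?y = x[j := i]"
    using x j by (auto simp: multi_indices_def upd_conv_take_nth_drop)
  ultimately show "P (x[j := i])" using L by metis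
next
  fix y assume R: "\<forall>x\<in>multi_indices ns. P (x[j := i])"
    and y: "y \<in> multi_indices (take j ns @ drop (Suc j) ns)"
  \<comment> \<open>The 0 is only a legal filler for mode \<open>j\<close>; it is overwritten by
    \<open>i\<close> below.\<close>
  let ?x = "take j y @ 0 # drop j y"
  have len: "length y = length ns - 1" using y j by (auto simp: multi_indices_def)
  have "?x ! l < ns ! l" if l: "l < length ns" for l
  proof (cases l j rule: linorder_cases)
    case less
    then have "y ! l < (take j ns @ drop (Suc j) ns) ! l"
      using y j by (auto simp: multi_indices_def)
    then show ?thesis using less len j by (simp add: nth_append)
  next
    case equal
    then show ?thesis using pos len j by (simp add: nth_append)
  next
    case greater
    then have "y ! (l - 1) < (take j ns @ drop (Suc j) ns) ! (l - 1)"
      using y j l by (auto simp: multi_indices_def)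
    moreover have "(take j ns @ drop (Suc j) ns) ! (l - 1) = ns ! l"
      using greater j l by (auto simp: nth_append min_def)
    moreover have "(take j y @ 0 # drop j y) ! l = y ! (l - 1)"
      using greater len j l by (auto simp: nth_append nth_Cons' min_def)
    ultimately show ?thesis by simp
  qed
  then have "?x \<in> multi_indices ns"
    using len j by (auto simp: multi_indices_def)
  moreover have "?x[j := i] = take j y @ i # drop j y"
    using len j by (simp add: list_update_append)
  ultimately show "P (take j y @ i # drop j y)" using R by metis
qed

lemma zero_pattern_slice_iff:
  assumes "j < length (dims A)" and "0 < dims A ! j"
  shows "zero_pattern (slice j i A) \<longleftrightarrow>
         (\<forall>x\<in>multi_indices (dims A). sgn (entry A (x[j := i])) = 0)"
  using ball_multi_indices_slice[OF assms, of "\<lambda>x. sgn (entry A x) = 0" i]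
  by (simp add: zero_pattern_def tensor_eq_def sgn_tensor_def const_tensor_def slice_def)

text \<open>The factor \<open>c\<close> merges the cases of equal and opposite patterns, so later
  arguments need no case split.\<close>

lemma same_or_neg_pattern_slice_iff:
  assumes "j < length (dims A)" and "0 < dims A ! j"
  shows "same_or_neg_pattern (slice j i A) (slice j i' A) \<longleftrightarrow>
         (\<exists>c\<in>{1, -1}. \<forall>x\<in>multi_indices (dims A).
            sgn (entry A (x[j := i])) = c * sgn (entry A (x[j := i'])))"
proof -
  have *: "(\<forall>y\<in>multi_indices (take j (dims A) @ drop (Suc j) (dims A)).
          sgn (entry A (take j y @ i # drop j y)) = c * sgn (entry A (take j y @ i' # drop j y)))
     \<longleftrightarrow> (\<forall>x\<in>multi_indices (dims A).
            sgn (entry A (x[j := i])) = c * sgn (entry A (x[j := i'])))" for c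
  proof -
    \<comment> \<open>The transfer lemma takes a predicate of one index only, so the entry in slice
      \<open>i'\<close> is expressed through the index in slice \<open>i\<close>.\<close>
    have upd: "take j y @ i' # drop j y = (take j y @ i # drop j y)[j := i']"
      if "y \<in> multi_indices (take j (dims A) @ drop (Suc j) (dims A))" for y
      using that assms by (auto simp: multi_indices_def list_update_append)
    have "(\<forall>y\<in>multi_indices (take j (dims A) @ drop (Suc j) (dims A)).
          sgn (entry A (take j y @ i # drop j y)) = c * sgn (entry A (take j y @ i' # drop j y)))
       \<longleftrightarrow> (\<forall>y\<in>multi_indices (take j (dims A) @ drop (Suc j) (dims A)).
          sgn (entry A (take j y @ i # drop j y))
            = c * sgn (entry A ((take j y @ i # drop j y)[j := i'])))"
      by (intro ball_cong refl) (simp only: upd)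
    then show ?thesis
      using ball_multi_indices_slice[OF assms,
          of "\<lambda>x. sgn (entry A x) = c * sgn (entry A (x[j := i']))" i]
      by simp
  qed
  show ?thesis
    using *[of 1] *[of "-1"]
    by (simp add: same_or_neg_pattern_def tensor_eq_def sgn_tensor_def neg_tensor_def slice_def)
qed


subsection \<open>Sign tensors of rank one\<close>

text \<open>The factors may be arbitrary real vectors: the sign of a product depends only on the
  signs of its factors, so no normalisation to sign vectors is required.\<close>

definition sign_rank_one :: "tensor \<Rightarrow> bool" where
  "sign_rank_one A \<longleftrightarrow>
     (\<exists>\<alpha>. (\<forall>j<length (dims A). \<exists>i<dims A ! j. \<alpha> j i \<noteq> 0) \<and>
          (\<forall>x\<in>multi_indices (dims A). sgn (entry A x) = sgn (\<Prod>j<length (dims A). \<alpha> j (x ! j))))"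

text \<open>Picking a nonzero component from every factor locates a nonzero entry of the outer
  product. Such an entry excludes rank 0 and later detects nonzero slices.\<close>

lemma multi_index_nonzero_factors:
  fixes \<alpha> :: "nat \<Rightarrow> nat \<Rightarrow> real"
  assumes "\<forall>j<length ns. \<exists>i<ns ! j. \<alpha> j i \<noteq> 0"
  obtains w where "w \<in> multi_indices ns" and "\<And>j. j < length ns \<Longrightarrow> \<alpha> j (w ! j) \<noteq> 0"
proof -
  obtain f where f: "\<forall>j<length ns. f j < ns ! j \<and> \<alpha> j (f j) \<noteq> 0"
    using assms by metis
  show ?thesis
    by (rule that[of "map f [0..<length ns]"]) (use f in \<open>auto simp: multi_indices_def\<close>)
qed

lemma rank_one_nonzero:
  assumes "rank_one B"
  obtains w where "w \<in> multi_indices (dims B)" and "entry B w \<noteq> 0"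
proof -
  obtain \<alpha> where \<alpha>: "\<forall>j<length (dims B). \<exists>i<dims B ! j. \<alpha> j i \<noteq> 0"
    and B: "B \<simeq> outer_product (dims B) \<alpha>"
    using assms unfolding rank_one_def by blast
  obtain w where w: "w \<in> multi_indices (dims B)"
    and "\<And>j. j < length (dims B) \<Longrightarrow> \<alpha> j (w ! j) \<noteq> 0"
    using multi_index_nonzero_factors[OF \<alpha>] by blast
  then have "entry B w \<noteq> 0"
    using B by (auto simp: tensor_eq_def outer_product_def)
  with w show ?thesis by (rule that)
qed

lemma rank_one_cong:
  assumes "A \<simeq> B" and "rank_one B"
  shows "rank_one A"
proof -
  have "dims A = dims B" using assms(1) by (simp add: tensor_eq_def)
  moreover have "A \<simeq> outer_product (dims B) \<alpha>" if "B \<simeq> outer_product (dims B) \<alpha>" for \<alpha>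
    using assms(1) that unfolding tensor_eq_def by metis
  ultimately show ?thesis using assms(2) unfolding rank_one_def by auto
qed

lemma sign_rank_one_iff: "sign_rank_one A \<longleftrightarrow> (\<exists>B\<in>sign_class A. rank_one B)"
proof
  assume "sign_rank_one A"
  then obtain \<alpha> where \<alpha>: "\<forall>j<length (dims A). \<exists>i<dims A ! j. \<alpha> j i \<noteq> 0"
    "\<forall>x\<in>multi_indices (dims A). sgn (entry A x) = sgn (\<Prod>j<length (dims A). \<alpha> j (x ! j))"
    unfolding sign_rank_one_def by blast
  have "outer_product (dims A) \<alpha> \<in> sign_class A"
    using \<alpha>(2) by (auto simp: sign_class_def sgn_tensor_def tensor_eq_def outer_product_def)
  moreover have "rank_one (outer_product (dims A) \<alpha>)"
    using \<alpha>(1) by (auto simp: rank_one_def outer_product_def tensor_eq_def intro!: exI[of _ \<alpha>])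
  ultimately show "\<exists>B\<in>sign_class A. rank_one B" by blast
next
  assume "\<exists>B\<in>sign_class A. rank_one B"
  then obtain B \<alpha> where "sgn_tensor B \<simeq> sgn_tensor A"
    "\<forall>j<length (dims B). \<exists>i<dims B ! j. \<alpha> j i \<noteq> 0" "B \<simeq> outer_product (dims B) \<alpha>"
    by (auto simp: sign_class_def rank_one_def)
  then show "sign_rank_one A"
    by (auto simp: sign_rank_one_def tensor_eq_def sgn_tensor_def outer_product_def
        intro!: exI[of _ \<alpha>])
qed


subsection \<open>Minimum rank one\<close>

text \<open>A tensor of order 0 is a scalar whose only rank one tensor is 1, hence the assumption.\<close>

lemma rank_decomposition_exists:
  assumes "dims A \<noteq> []"
  shows "\<exists>r T. (\<forall>l<r. dims (T l) = dims A \<and> rank_one (T l)) \<and> A \<simeq> sum_tensor (dims A) r T"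
proof -
  define S where "S = {x \<in> multi_indices (dims A). entry A x \<noteq> 0}"
  have "finite S" unfolding S_def using finite_multi_indices by simp
  then obtain h where h: "bij_betw h {..<card S} S"
    using ex_bij_betw_nat_finite by (metis atLeast0LessThan)
  \<comment> \<open>Unit vectors whose outer product is the indicator of \<open>x\<close>, with the
    entry of \<open>A\<close> at \<open>x\<close> absorbed into mode 0. The tensor is the sum of
    these over its support.\<close>
  define \<alpha> where "\<alpha> x = (\<lambda>j i. if i = x ! j then (if j = 0 then entry A x else 1) else 0)" for x
  define T where "T l = outer_product (dims A) (\<alpha> (h l))" for l
  have prod: "(\<Prod>j<length (dims A). \<alpha> x j (y ! j)) = (if y = x then entry A x else 0)"
    if "x \<in> S" "y \<in> multi_indices (dims A)" for x y
  proof (cases "y = x")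
    case True
    then have "(\<Prod>j<length (dims A). \<alpha> x j (y ! j)) =
               (\<Prod>j<length (dims A). if j = 0 then entry A x else 1)"
      by (intro prod.cong) (auto simp: \<alpha>_def)
    also have "\<dots> = entry A x" using assms by (simp add: prod.delta)
    finally show ?thesis using True by simp
  next
    case False
    moreover have "length y = length (dims A)" "length x = length (dims A)"
      using that by (auto simp: S_def multi_indices_def)
    ultimately obtain j where "j < length (dims A)" "y ! j \<noteq> x ! j"
      by (metis nth_equalityI)
    then have "(\<Prod>j<length (dims A). \<alpha> x j (y ! j)) = 0"
      by (intro prod_zero bexI[of _ j]) (auto simp: \<alpha>_def)
    then show ?thesis using False by simp
  qed
  have one: "dims (T l) = dims A \<and> rank_one (T l)" if "l < card S" for l
  proof -
    have "h l \<in> S" using h that by (auto dest: bij_betwE)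
    then have "\<forall>j<length (dims A). \<exists>i<dims A ! j. \<alpha> (h l) j i \<noteq> 0"
      by (auto simp: S_def multi_indices_def \<alpha>_def intro!: exI[of _ "h l ! _"])
    then show ?thesis
      by (auto simp: T_def rank_one_def outer_product_def tensor_eq_def
          intro!: exI[of _ "\<alpha> (h l)"])
  qed
  have "entry A y = (\<Sum>l<card S. entry (T l) y)" if y: "y \<in> multi_indices (dims A)" for y
  proof -
    have "(\<Sum>l<card S. entry (T l) y) = (\<Sum>l<card S. if y = h l then entry A (h l) else 0)"
      using prod[OF _ y] bij_betwE[OF h] by (intro sum.cong refl) (simp add: T_def outer_product_def)
    also have "\<dots> = (\<Sum>x\<in>S. if y = x then entry A x else 0)"
      by (rule sum.reindex_bij_betw[OF h])
    also have "\<dots> = entry A y"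
      using \<open>finite S\<close> y by (auto simp: sum.delta' S_def)
    finally show ?thesis by simp
  qed
  then have "A \<simeq> sum_tensor (dims A) (card S) T"
    by (auto simp: tensor_eq_def sum_tensor_def)
  with one show ?thesis by blast
qed

text \<open>The \<open>LEAST\<close> defining the rank is attained because some decomposition
  exists.\<close>

lemma tensor_rank_decomposition:
  assumes "dims A \<noteq> []"
  obtains T where "\<forall>l<tensor_rank A. dims (T l) = dims A \<and> rank_one (T l)"
    and "A \<simeq> sum_tensor (dims A) (tensor_rank A) T"
  using LeastI_ex[OF rank_decomposition_exists[OF assms], folded tensor_rank_def] that by auto

lemma tensor_rank_eq_1_iff:
  assumes "dims B \<noteq> []"
  shows "tensor_rank B = 1 \<longleftrightarrow> rank_one B"
proof
  assume "tensor_rank B = 1"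
  then obtain T where T: "rank_one (T (0::nat))" "dims (T 0) = dims B" "B \<simeq> sum_tensor (dims B) 1 T"
    using tensor_rank_decomposition[OF assms] by (metis less_numeral_extra(1))
  then have "B \<simeq> T 0" by (auto simp: tensor_eq_def sum_tensor_def)
  then show "rank_one B" using T rank_one_cong by blast
next
  assume B: "rank_one B"
  obtain w where w: "w \<in> multi_indices (dims B)" "entry B w \<noteq> 0"
    using rank_one_nonzero[OF B] by blast
  show "tensor_rank B = 1"
    unfolding tensor_rank_def
  proof (rule Least_equality)
    show "\<exists>T. (\<forall>l<1. dims (T l) = dims B \<and> rank_one (T l)) \<and> B \<simeq> sum_tensor (dims B) 1 T"
      using B by (intro exI[of _ "\<lambda>_. B"]) (auto simp: tensor_eq_def sum_tensor_def)
  next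
    fix r
    assume "\<exists>T. (\<forall>l<r. dims (T l) = dims B \<and> rank_one (T l)) \<and> B \<simeq> sum_tensor (dims B) r T"
    \<comment> \<open>For \<open>r = 0\<close> the empty sum would vanish at
      \<open>w\<close>.\<close>
    then show "1 \<le> r" using w by (cases r) (auto simp: tensor_eq_def sum_tensor_def)
  qed
qed

lemma tensor_rank_pos:
  assumes "w \<in> multi_indices (dims B)" and "entry B w \<noteq> 0" and "dims B \<noteq> []"
  shows "0 < tensor_rank B"
proof (rule ccontr)
  assume "\<not> 0 < tensor_rank B"
  then obtain T where "B \<simeq> sum_tensor (dims B) 0 T"
    using tensor_rank_decomposition[OF assms(3)] by (metis gr0I)
  then show False using assms by (auto simp: tensor_eq_def sum_tensor_def)
qed

text \<open>The minimum is attained in the sign class, which gives one direction. Conversely, a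
  nonzero entry of a rank one member is nonzero in every member, so no member has rank 0.\<close>

lemma mr_eq_1_iff:
  assumes "dims A \<noteq> []"
  shows "mr A = 1 \<longleftrightarrow> sign_rank_one A"
proof -
  have dims: "dims B = dims A"
    and sgn: "\<forall>x\<in>multi_indices (dims A). sgn (entry B x) = sgn (entry A x)"
    if "B \<in> sign_class A" for B
    using that by (simp_all add: sign_class_def tensor_eq_def sgn_tensor_def)
  have "A \<in> sign_class A" by (simp add: sign_class_def tensor_eq_def)
  then have "\<exists>r. \<exists>B\<in>sign_class A. tensor_rank B = r" by blast
  from LeastI_ex[OF this] have attained: "\<exists>B\<in>sign_class A. tensor_rank B = mr A"
    unfolding mr_def .
  show ?thesis
    unfolding sign_rank_one_iff
  proof
    assume "mr A = 1"
    with attained show "\<exists>B\<in>sign_class A. rank_one B"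
      using tensor_rank_eq_1_iff dims assms by metis
  next
    assume "\<exists>B\<in>sign_class A. rank_one B"
    then obtain B where B: "B \<in> sign_class A" "rank_one B" by blast
    obtain w where w: "w \<in> multi_indices (dims B)" "entry B w \<noteq> 0"
      using rank_one_nonzero[OF B(2)] by blast
    show "mr A = 1"
      unfolding mr_def
    proof (rule Least_equality)
      show "\<exists>B\<in>sign_class A. tensor_rank B = 1"
        using B tensor_rank_eq_1_iff[of B] dims assms by metis
    next
      fix r assume "\<exists>B'\<in>sign_class A. tensor_rank B' = r"
      then obtain B' where B': "B' \<in> sign_class A" "tensor_rank B' = r" by blast
      have "sgn (entry B' w) = sgn (entry B w)"
        using sgn[OF B(1)] sgn[OF B'(1)] w(1) dims[OF B(1)] by simp
      then have "entry B' w \<noteq> 0" using w(2) by (metis sgn_0_0)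
      then show "1 \<le> r"
        using tensor_rank_pos[of w B'] w(1) dims[OF B(1)] dims[OF B'(1)] B'(2) assms by simp
    qed
  qed
qed


subsection \<open>Invariance under condensation\<close>

text \<open>Along mode \<open>j\<close> an outer product is the \<open>j\<close>-th factor times a
  cofactor independent of the index in that mode.\<close>

lemma prod_update_factor:
  fixes \<alpha> :: "nat \<Rightarrow> nat \<Rightarrow> real"
  assumes "j < k" and "length x = k"
  shows "(\<Prod>l<k. \<alpha> l (x[j := i] ! l)) = \<alpha> j i * (\<Prod>l\<in>{..<k} - {j}. \<alpha> l (x ! l))"
proof -
  have "(\<Prod>l<k. \<alpha> l (x[j := i] ! l)) =
        \<alpha> j (x[j := i] ! j) * (\<Prod>l\<in>{..<k} - {j}. \<alpha> l (x[j := i] ! l))"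
    using assms by (intro prod.remove) auto
  also have "(\<Prod>l\<in>{..<k} - {j}. \<alpha> l (x[j := i] ! l)) = (\<Prod>l\<in>{..<k} - {j}. \<alpha> l (x ! l))"
    by (intro prod.cong) auto
  finally show ?thesis using assms by simp
qed

text \<open>Every slice of mode \<open>j\<close> has the pattern of one common cofactor
  \<open>P\<close>, multiplied by the sign of \<open>\<alpha> j i\<close>. Since \<open>P\<close> is
  nonzero at \<open>w\<close>, the nonzero slices are those with
  \<open>\<alpha> j i \<noteq> 0\<close>, and they form a single class.\<close>

lemma kept_indices_sign_rank_one:
  assumes "sign_rank_one A" and j: "j < length (dims A)" and K: "K \<in> kept_indices j A"
  shows "card K = 1" and "sign_rank_one (keep_slices j K A)"
proof -
  let ?k = "length (dims A)"
  obtain \<alpha> where \<alpha>: "\<forall>l<?k. \<exists>i<dims A ! l. \<alpha> l i \<noteq> 0"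
    "\<forall>x\<in>multi_indices (dims A). sgn (entry A x) = sgn (\<Prod>l<?k. \<alpha> l (x ! l))"
    using assms(1) unfolding sign_rank_one_def by blast
  define P where "P x = (\<Prod>l\<in>{..<?k} - {j}. \<alpha> l (x ! l))" for x
  have sgn: "sgn (entry A (x[j := i])) = sgn (\<alpha> j i) * sgn (P x)"
    if "x \<in> multi_indices (dims A)" "i < dims A ! j" for x i
  proof -
    have "length x = ?k" using that by (simp add: multi_indices_def)
    then show ?thesis
      using \<alpha>(2) multi_indices_update_same[OF that] j
      by (simp add: prod_update_factor P_def sgn_mult)
  qed
  obtain w where w: "w \<in> multi_indices (dims A)" "\<And>l. l < ?k \<Longrightarrow> \<alpha> l (w ! l) \<noteq> 0"
    using multi_index_nonzero_factors[OF \<alpha>(1)] by blast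
  have Pw: "P w \<noteq> 0" using w(2) by (auto simp: P_def)
  have pos: "0 < dims A ! j" using \<alpha>(1) j by fastforce
  have zero: "zero_pattern (slice j i A) \<longleftrightarrow> \<alpha> j i = 0" if "i < dims A ! j" for i
    using that w(1) Pw sgn by (auto simp: zero_pattern_slice_iff[OF j pos] sgn_0_0)
  have same: "same_or_neg_pattern (slice j i A) (slice j i' A)"
    if "i < dims A ! j" "i' < dims A ! j" "\<alpha> j i \<noteq> 0" "\<alpha> j i' \<noteq> 0" for i i'
    unfolding same_or_neg_pattern_slice_iff[OF j pos]
    \<comment> \<open>Both signs are nonzero and hence their own inverses, so their product is the
      ratio of the two slices.\<close>
    by (rule bexI[of _ "sgn (\<alpha> j i) * sgn (\<alpha> j i')"])
      (use that sgn in \<open>auto simp: sgn_if\<close>)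
  have Kbnd: "i < dims A ! j \<and> \<alpha> j i \<noteq> 0" if "i \<in> K" for i
    using K that zero unfolding kept_indices_def by blast
  \<comment> \<open>A nonzero slice exists, so the covering condition makes \<open>K\<close>
    nonempty.\<close>
  obtain i0 where "i0 < dims A ! j" "\<alpha> j i0 \<noteq> 0" using \<alpha>(1) j by blast
  then obtain k0 where k0: "k0 \<in> K" using K zero unfolding kept_indices_def by blast
  have Keq: "K = {k0}"
    using K k0 same Kbnd unfolding kept_indices_def by blast
  then show "card K = 1" by simp
  \<comment> \<open>The only index left in mode \<open>j\<close> is 0 and stands for the old index
    \<open>k0\<close>; a factor constantly equal to \<open>\<alpha> j k0\<close> avoids
    renumbering.\<close>
  have "sgn (entry A (x[j := k0])) = sgn (\<Prod>l<?k. (\<alpha>(j := \<lambda>_. \<alpha> j k0)) l (x ! l))"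
    if x: "x \<in> multi_indices ((dims A)[j := 1])" for x
  proof -
    have len: "length x = ?k" using x by (simp add: multi_indices_def)
    have mem: "x[j := k0] \<in> multi_indices (dims A)"
      using multi_indices_update[OF x, of k0 "dims A ! j" j] Kbnd[OF k0] by simp
    have "(\<Prod>l<?k. (\<alpha>(j := \<lambda>_. \<alpha> j k0)) l (x ! l)) = (\<Prod>l<?k. \<alpha> l (x[j := k0] ! l))"
      using len by (intro prod.cong) (auto simp: nth_list_update)
    then show ?thesis using \<alpha>(2) mem by simp
  qed
  moreover have "x ! j = 0" if "x \<in> multi_indices ((dims A)[j := 1])" for x
    using that j unfolding multi_indices_def by fastforce
  moreover have "\<exists>i<(dims A)[j := 1] ! l. (\<alpha>(j := \<lambda>_. \<alpha> j k0)) l i \<noteq> 0" if "l < ?k" for l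
    using \<alpha>(1) Kbnd[OF k0] that by (cases "l = j") auto
  ultimately show "sign_rank_one (keep_slices j K A)"
    unfolding sign_rank_one_def Keq
    by (intro exI[of _ "\<alpha>(j := \<lambda>_. \<alpha> j k0)"]) (simp add: keep_slices_def)
qed

text \<open>Each original slice is 0 or a signed copy of a kept one, so the factor of mode
  \<open>j\<close> extends to the deleted indices while the other factors stay.\<close>

lemma sign_rank_one_keep_slicesD:
  assumes rk: "sign_rank_one (keep_slices j K A)"
    and j: "j < length (dims A)" and K: "K \<in> kept_indices j A"
  shows "sign_rank_one A"
proof -
  let ?k = "length (dims A)"
  let ?s = "sorted_list_of_set K"
  obtain \<beta> where \<beta>: "\<forall>l<?k. \<exists>i<(dims A)[j := card K] ! l. \<beta> l i \<noteq> 0"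
    and sgn: "\<forall>x\<in>multi_indices ((dims A)[j := card K]).
       sgn (entry A (x[j := ?s ! (x ! j)])) = sgn (\<Prod>l<?k. \<beta> l (x ! l))"
    using rk unfolding sign_rank_one_def keep_slices_def by auto
  have sub: "K \<subseteq> {..<dims A ! j}" using K unfolding kept_indices_def by blast
  then have fin: "finite K" by (rule finite_subset) simp
  \<comment> \<open>Besides showing that \<open>K\<close> is nonempty, \<open>p0\<close> serves as
    the default position for zero slices.\<close>
  obtain p0 where p0: "p0 < card K" "\<beta> j p0 \<noteq> 0" using \<beta> j by auto
  have s_mem: "?s ! p \<in> K" if "p < card K" for p
    using that fin by (metis nth_mem set_sorted_list_of_set length_sorted_list_of_set)
  have pos: "0 < dims A ! j" using s_mem[OF p0(1)] sub by fastforce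
  \<comment> \<open>Slice \<open>i\<close> is \<open>c\<close> times the kept slice at position
    \<open>p\<close>, with \<open>c = 0\<close> for zero slices. The last conjunct makes a kept
    slice represent itself, so that the extended factor does not vanish.\<close>
  have "\<exists>c p. p < card K \<and> (\<forall>x\<in>multi_indices (dims A).
           sgn (entry A (x[j := i])) = sgn c * sgn (entry A (x[j := ?s ! p]))) \<and>
         (i \<in> K \<longrightarrow> c \<noteq> 0 \<and> ?s ! p = i)" if i: "i < dims A ! j" for i
  proof (cases "zero_pattern (slice j i A)")
    case True
    then have "i \<notin> K" using K unfolding kept_indices_def by blast
    then show ?thesis
      using True p0 by (intro exI[of _ 0] exI[of _ p0])
        (auto simp: zero_pattern_slice_iff[OF j pos] sgn_0_0)
  next
    case False
    then obtain i' where i': "i' \<in> K" "same_or_neg_pattern (slice j i A) (slice j i' A)"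
      using K i unfolding kept_indices_def by blast
    then have "i \<in> K \<longrightarrow> i' = i" using K unfolding kept_indices_def by blast
    moreover obtain p where "p < card K" "?s ! p = i'"
      using i'(1) fin by (metis in_set_conv_nth set_sorted_list_of_set length_sorted_list_of_set)
    moreover obtain c where "c \<in> {1, -1::real}" "\<forall>x\<in>multi_indices (dims A).
           sgn (entry A (x[j := i])) = c * sgn (entry A (x[j := i']))"
      using i'(2) unfolding same_or_neg_pattern_slice_iff[OF j pos] by blast
    ultimately show ?thesis
      by (intro exI[of _ c] exI[of _ p]) auto
  qed
  then obtain c p where cp: "\<And>i. i < dims A ! j \<Longrightarrow> p i < card K"
    "\<And>i x. \<lbrakk>i < dims A ! j; x \<in> multi_indices (dims A)\<rbrakk> \<Longrightarrow>
       sgn (entry A (x[j := i])) = sgn (c i) * sgn (entry A (x[j := ?s ! p i]))"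
    "\<And>i. \<lbrakk>i < dims A ! j; i \<in> K\<rbrakk> \<Longrightarrow> c i \<noteq> 0 \<and> ?s ! p i = i"
    by metis
  define \<alpha> where "\<alpha> = \<beta>(j := \<lambda>i. c i * \<beta> j (p i))"
  have "\<exists>i<dims A ! l. \<alpha> l i \<noteq> 0" if l: "l < ?k" for l
  proof (cases "l = j")
    case True
    let ?i = "?s ! p0"
    have i: "?i \<in> K" "?i < dims A ! j" using s_mem[OF p0(1)] sub by auto
    \<comment> \<open>The list of kept indices is distinct, so the position of its entry at
      \<open>p0\<close> is \<open>p0\<close>. The new component there is a nonzero multiple of
      \<open>\<beta> j p0\<close>.\<close>
    have "p ?i = p0"
      using cp(3)[OF i(2,1)] cp(1)[OF i(2)] p0(1) fin
      by (metis distinct_sorted_list_of_set nth_eq_iff_index_eq length_sorted_list_of_set)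
    then show ?thesis using True i cp(3) p0(2) by (auto simp: \<alpha>_def intro!: exI[of _ ?i])
  next
    case False
    then have "(dims A)[j := card K] ! l = dims A ! l" by simp
    then show ?thesis using \<beta> l False by (metis \<alpha>_def fun_upd_other)
  qed
  moreover have "sgn (entry A x) = sgn (\<Prod>l<?k. \<alpha> l (x ! l))"
    if x: "x \<in> multi_indices (dims A)" for x
  proof -
    let ?i = "x ! j"
    have len: "length x = ?k" and i: "?i < dims A ! j"
      using x j by (auto simp: multi_indices_def)
    have mem: "x[j := p ?i] \<in> multi_indices ((dims A)[j := card K])"
      using multi_indices_update[OF x cp(1)[OF i]] .
    have "sgn (entry A x) = sgn (c ?i) * sgn (entry A (x[j := ?s ! p ?i]))"
      using cp(2)[OF i x] by simp
    also have "entry A (x[j := ?s ! p ?i]) =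
        entry A ((x[j := p ?i])[j := ?s ! ((x[j := p ?i]) ! j)])"
      using len j by simp
    also have "sgn \<dots> = sgn (\<Prod>l<?k. \<beta> l (x[j := p ?i] ! l))"
      using sgn mem by blast
    also have "(\<Prod>l<?k. \<beta> l (x[j := p ?i] ! l)) =
        \<beta> j (p ?i) * (\<Prod>l\<in>{..<?k} - {j}. \<beta> l (x ! l))"
      using prod_update_factor[OF j len] .
    also have "(\<Prod>l\<in>{..<?k} - {j}. \<beta> l (x ! l)) = (\<Prod>l\<in>{..<?k} - {j}. \<alpha> l (x ! l))"
      by (intro prod.cong) (auto simp: \<alpha>_def)
    also have "sgn (c ?i) * sgn (\<beta> j (p ?i) * \<dots>) =
        sgn (\<alpha> j ?i * (\<Prod>l\<in>{..<?k} - {j}. \<alpha> l (x ! l)))"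
      by (simp add: \<alpha>_def sgn_mult)
    also have "\<alpha> j ?i * (\<Prod>l\<in>{..<?k} - {j}. \<alpha> l (x ! l)) = (\<Prod>l<?k. \<alpha> l (x ! l))"
      using prod_update_factor[OF j len, of \<alpha> ?i] by simp
    finally show ?thesis .
  qed
  ultimately show ?thesis unfolding sign_rank_one_def by blast
qed

text \<open>Induction over the processed modes. Forward, each step reduces its own mode to dimension
  1 and leaves the other dimensions alone; backward, each step reflects
  \<open>sign_rank_one\<close>.\<close>

lemma condensed_tensors_sign_rank_one:
  assumes "C \<in> condensed_tensors A"
  shows "sign_rank_one A \<longleftrightarrow> sign_rank_one C \<and> dims C = replicate (length (dims A)) 1"
proof -
  let ?k = "length (dims A)"
  obtain T where T0: "T 0 = A" and C: "C = T ?k"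
    and step: "\<And>j. j < ?k \<Longrightarrow> \<exists>K\<in>kept_indices j (T j). T (Suc j) = keep_slices j K (T j)"
    using assms unfolding condensed_tensors_def by blast
  have len: "length (dims (T j)) = ?k" if "j \<le> ?k" for j
    using that
  proof (induction j)
    case (Suc j)
    then show ?case using step[of j] by (auto simp: keep_slices_def)
  qed (simp add: T0)
  have fwd: "sign_rank_one (T j) \<and> (\<forall>l<j. dims (T j) ! l = 1)" if "sign_rank_one A" "j \<le> ?k" for j
    using that(2)
  proof (induction j)
    case (Suc j)
    then obtain K where K: "K \<in> kept_indices j (T j)" "T (Suc j) = keep_slices j K (T j)"
      using step[of j] by auto
    have j: "j < length (dims (T j))" using len[of j] Suc.prems by simp
    have "sign_rank_one (T j)" using Suc by simp
    note kept_indices_sign_rank_one[OF this j K(1)]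
    then show ?case using Suc j K(2)
      by (auto simp: keep_slices_def nth_list_update less_Suc_eq)
  qed (use that T0 in simp)
  have bwd: "sign_rank_one (T j) \<Longrightarrow> sign_rank_one A" if "j \<le> ?k" for j
    using that
  proof (induction j)
    case (Suc j)
    then obtain K where "K \<in> kept_indices j (T j)" "T (Suc j) = keep_slices j K (T j)"
      using step[of j] by auto
    then show ?case
      using Suc len[of j] sign_rank_one_keep_slicesD[of j K "T j"] by simp
  qed (simp add: T0)
  show ?thesis
    using fwd[of ?k] bwd[of ?k] len[of ?k] C by (auto simp: list_eq_iff_nth_eq)
qed

section \<open>Tensors with a single entry and the conclusion\<close>

lemma multi_indices_ones: "multi_indices (replicate k 1) = {replicate k 0}"
  by (auto simp: multi_indices_def list_eq_iff_nth_eq)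

text \<open>For \<open>k = 0\<close> the empty product is 1, so a negative scalar would be a
  counterexample.\<close>

lemma sign_rank_one_single_entry:
  assumes "dims C = replicate k 1" and "k \<noteq> 0"
  shows "sign_rank_one C \<longleftrightarrow> entry C (replicate k 0) \<noteq> 0"
proof
  let ?z = "replicate k (0::nat)"
  assume "sign_rank_one C"
  then obtain \<alpha> where "\<forall>l<k. \<exists>i<replicate k 1 ! l. \<alpha> l i \<noteq> 0"
    and eq: "sgn (entry C ?z) = sgn (\<Prod>l<k. \<alpha> l (?z ! l))"
    unfolding sign_rank_one_def assms multi_indices_ones by auto
  then have "(\<Prod>l<k. \<alpha> l (?z ! l)) \<noteq> 0" by auto
  with eq show "entry C ?z \<noteq> 0" by (metis sgn_0_0)
next
  let ?z = "replicate k (0::nat)"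
  assume "entry C ?z \<noteq> 0"
  then show "sign_rank_one C"
    unfolding sign_rank_one_def assms multi_indices_ones
    \<comment> \<open>Mode 0 carries the whole entry; all other factors are 1.\<close>
    using assms(2) by (intro exI[of _ "\<lambda>j _. if j = 0 then entry C ?z else 1"])
      (auto simp: prod.delta)
qed

theorem theorem3p3:
  fixes A C :: tensor and ns :: "nat list"
  assumes "dims A = ns"
    and "length ns \<ge> 1"
    and "\<forall>n\<in>set ns. n \<ge> 1"
    and "C \<in> condensed_tensors A"
  shows "mr A = 1 \<longleftrightarrow>
      sgn_tensor C \<simeq> const_tensor (replicate (length ns) 1) 1 \<or>
      sgn_tensor C \<simeq> const_tensor (replicate (length ns) 1) (-1)"
proof -
  let ?k = "length ns"
  have "mr A = 1 \<longleftrightarrow> sign_rank_one A"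
    using assms(1,2) by (intro mr_eq_1_iff) auto
  also have "\<dots> \<longleftrightarrow> dims C = replicate ?k 1 \<and> entry C (replicate ?k 0) \<noteq> 0"
    using condensed_tensors_sign_rank_one[OF assms(4)] sign_rank_one_single_entry[of C ?k]
      assms(1,2) by (metis list.size(3) not_one_le_zero length_0_conv)
  also have "\<dots> \<longleftrightarrow> sgn_tensor C \<simeq> const_tensor (replicate ?k 1) 1 \<or>
      sgn_tensor C \<simeq> const_tensor (replicate ?k 1) (-1)"
  \<comment> \<open>With all dimensions 1 there is one sign to compare, and it is 1 or -1 exactly if
    the entry is nonzero. Otherwise both sides fail, as \<open>\<simeq>\<close> compares
    dimensions.\<close>
  proof (cases "dims C = replicate ?k 1")
    case True
    then show ?thesis
      using multi_indices_ones[of ?k]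
      by (simp add: tensor_eq_def sgn_tensor_def const_tensor_def sgn_if)
  qed (simp add: tensor_eq_def sgn_tensor_def const_tensor_def)
  finally show ?thesis .
qed

end
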